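(* Let $\Omega$ be a finite set of items, let $m\ge 1$, $l\ge 2$ and $k\ge 0$ be integers, and let $f_1,\dots,f_m:2^\Omega\to\mathbb{R}_{\ge 0}$ be monotone submodular functions. Let $(S_1,\dots,S_l)$ be the output of the $l$-group enumeration algorithm run with a subroutine of approximation factor $1-1/e$. Then $|S_j|\le k$ for all $j\in\{1,\dots,l\}$ and $$\sum_{i\in[m]}\max\{f_i(S_1),\dots,f_i(S_l)\}\ \ge\ (1-1/e)\max_{\substack{S_1',\dots,S_l'\subseteq\Omega\\ |S_1'|\le k,\dots,|S_l'|\le k}}\ \sum_{i\in[m]}\max\{f_i(S_1'),\dots,f_i(S_l')\}.$$
   Context: $[m]=\{1,\dots,m\}$. A function $f:2^\Omega\to\mathbb{R}_{\ge0}$ is submodular if $f(A\cup\{x\})-f(A)\ge f(A'\cup\{x\})-f(A')$ for all $A\subseteq A'\subseteq\Omega$ and $x\in\Omega\setminus A'$; it is monotone if $f(A)\le f(A')$ whenever $A\subseteq A'$. Subroutine of approximation factor $\alpha$: a procedure which, for any $A\subseteq[m]$, returns a set $C\subseteq\Omega$ with $|C|\le k$ and $\sum_{i\in A}f_i(C)\ge\alpha\max_{S\subseteq\Omega,|S|\le k}\sum_{i\in A}f_i(S)$. $l$-group enumeration algorithm: enumerate all ways to partition $[m]$ into $l$ (possibly empty) groups $A_1,\dots,A_l$. For each partition, let $C_j$ be the set returned by the subroutine for $A_j$, $j=1,\dots,l$. Return a tuple $(C_1,\dots,C_l)$ with the largest value of $\sum_{i\in[m]}\max\{f_i(C_1),\dots,f_i(C_l)\}$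 among all enumerated partitions. *)

theory Defs
  imports Complex_Main "HOL-Library.FuncSet" "HOL-Library.Disjoint_Sets"
begin

definition submodular_on :: "'a set \<Rightarrow> ('a set \<Rightarrow> real) \<Rightarrow> bool" where
  "submodular_on \<Omega> f \<longleftrightarrow>
     (\<forall>A B x. A \<subseteq> B \<and> B \<subseteq> \<Omega> \<and> x \<in> \<Omega> - B \<longrightarrow>
        f (insert x A) - f A \<ge> f (insert x B) - f B)"

definition feasible_sets :: "'a set \<Rightarrow> nat \<Rightarrow> 'a set set" where
  "feasible_sets \<Omega> k = {S. S \<subseteq> \<Omega> \<and> card S \<le> k}"

(* A tuple (S_1, ..., S_l) is a function on {1..l}, extended by undefined outside {1..l}. *)
definition feasible_tuples :: "'a set \<Rightarrow> nat \<Rightarrow> nat \<Rightarrow> (nat \<Rightarrow> 'a set) set" where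
  "feasible_tuples \<Omega> k l = {1..l} \<rightarrow>\<^sub>E feasible_sets \<Omega> k"

definition tuple_value :: "(nat \<Rightarrow> 'a set \<Rightarrow> real) \<Rightarrow> nat \<Rightarrow> nat \<Rightarrow> (nat \<Rightarrow> 'a set) \<Rightarrow> real" where
  "tuple_value f m l S = (\<Sum>i\<in>{1..m}. Max ((\<lambda>j. f i (S j)) ` {1..l}))"

(* The subroutine is represented by its input-output map sub on the subsets of {1..m}. *)
definition approx_subroutine ::
  "real \<Rightarrow> 'a set \<Rightarrow> nat \<Rightarrow> (nat \<Rightarrow> 'a set \<Rightarrow> real) \<Rightarrow> nat \<Rightarrow> (nat set \<Rightarrow> 'a set) \<Rightarrow> bool" where
  "approx_subroutine \<alpha> \<Omega> k f m sub \<longleftrightarrow>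
     (\<forall>A. A \<subseteq> {1..m} \<longrightarrow>
        sub A \<subseteq> \<Omega> \<and> card (sub A) \<le> k \<and>
        (\<Sum>i\<in>A. f i (sub A)) \<ge> \<alpha> * Max ((\<lambda>S. \<Sum>i\<in>A. f i S) ` feasible_sets \<Omega> k))"

(* Partitions into l labelled, possibly empty groups; partition_on would exclude empty groups. *)
definition group_partitions :: "nat \<Rightarrow> nat \<Rightarrow> (nat \<Rightarrow> nat set) set" where
  "group_partitions m l =
     {A \<in> {1..l} \<rightarrow>\<^sub>E Pow {1..m}. disjoint_family_on A {1..l} \<and> (\<Union>j\<in>{1..l}. A j) = {1..m}}"

definition group_candidates :: "nat \<Rightarrow> nat \<Rightarrow> (nat set \<Rightarrow> 'a set) \<Rightarrow> (nat \<Rightarrow> 'a set) set" where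
  "group_candidates m l sub = (\<lambda>A. \<lambda>j\<in>{1..l}. sub (A j)) ` group_partitions m l"

(* A predicate rather than a function, because ties between candidates may be broken arbitrarily. *)
definition group_enumeration_output ::
  "(nat \<Rightarrow> 'a set \<Rightarrow> real) \<Rightarrow> nat \<Rightarrow> nat \<Rightarrow> (nat set \<Rightarrow> 'a set) \<Rightarrow> (nat \<Rightarrow> 'a set) \<Rightarrow> bool" where
  "group_enumeration_output f m l sub S \<longleftrightarrow>
     is_arg_max (tuple_value f m l) (\<lambda>C. C \<in> group_candidates m l sub) S"

lemma group_enumeration_output_exists:
  assumes "l \<ge> 1"
  shows "\<exists>S. group_enumeration_output f m l sub S"
proof -
  have fin: "finite (group_candidates m l sub)"
    unfolding group_candidates_def group_partitions_def
    by (intro finite_imageI finite_Collect_conjI disjI1)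
       (simp add: finite_PiE flip: PiE_def)
  have "(\<lambda>j\<in>{1..l}. if j = 1 then {1..m} else {}) \<in> group_partitions m l"
    using assms by (auto simp: group_partitions_def disjoint_family_on_def)
  then have ne: "group_candidates m l sub \<noteq> {}"
    unfolding group_candidates_def by blast
  let ?V = "tuple_value f m l ` group_candidates m l sub"
  have "Max ?V \<in> ?V"
    using fin ne by (intro Max_in) auto
  then obtain S where S: "S \<in> group_candidates m l sub" "tuple_value f m l S = Max ?V"
    by (metis imageE)
  then have "\<not> tuple_value f m l C > tuple_value f m l S" if "C \<in> group_candidates m l sub" for C
    using fin that by (simp add: linorder_not_less)
  then show ?thesis
    using S(1) unfolding group_enumeration_output_def is_arg_max_def by blast
qed

end

theory Submission
  imports Defs
begin

text \<open>
  Given any feasible tuple \<open>T\<close>, assign each \<open>i\<close> to a group \<open>j\<close> at which \<open>f i (T j)\<close> is maximal.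
  The algorithm enumerates this partition, and on each of its groups the subroutine does at least
  \<open>\<alpha>\<close> times as well as \<open>T j\<close>; summing over the groups loses nothing on the side of \<open>T\<close>.
\<close>

lemma finite_feasible_sets: "finite \<Omega> \<Longrightarrow> finite (feasible_sets \<Omega> k)"
  unfolding feasible_sets_def by simp

lemma finite_feasible_tuples: "finite \<Omega> \<Longrightarrow> finite (feasible_tuples \<Omega> k l)"
  unfolding feasible_tuples_def by (simp add: finite_PiE finite_feasible_sets)

lemma feasible_tuples_nonempty: "feasible_tuples \<Omega> k l \<noteq> {}"
proof -
  have "{} \<in> feasible_sets \<Omega> k"
    by (simp add: feasible_sets_def)
  then show ?thesis
    unfolding feasible_tuples_def by (metis PiE_eq_empty_iff empty_iff)
qed

text \<open>This trades the maximum in the subroutine's guarantee for one chosen competitor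
  \<open>T\<close>. As \<Omega> is finite, \<open>Max\<close> really bounds the value of
  \<open>T\<close>, and \<alpha> \<ge> 0 preserves the inequality under scaling.\<close>

lemma approx_subroutine_ge:
  assumes "finite \<Omega>" "0 \<le> \<alpha>" "approx_subroutine \<alpha> \<Omega> k f m sub"
    and "A \<subseteq> {1..m}" "T \<in> feasible_sets \<Omega> k"
  shows "\<alpha> * (\<Sum>i\<in>A. f i T) \<le> (\<Sum>i\<in>A. f i (sub A))"
proof -
  have "(\<Sum>i\<in>A. f i T) \<le> Max ((\<lambda>S. \<Sum>i\<in>A. f i S) ` feasible_sets \<Omega> k)"
    using assms finite_feasible_sets by (intro Max_ge) auto
  then have "\<alpha> * (\<Sum>i\<in>A. f i T) \<le> \<alpha> * Max ((\<lambda>S. \<Sum>i\<in>A. f i S) ` feasible_sets \<Omega> k)"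
    using assms(2) by (rule mult_left_mono)
  also have "\<dots> \<le> (\<Sum>i\<in>A. f i (sub A))"
    using assms(3,4) unfolding approx_subroutine_def by blast
  finally show ?thesis .
qed

lemma group_candidate_card_le:
  assumes "approx_subroutine \<alpha> \<Omega> k f m sub" "C \<in> group_candidates m l sub" "j \<in> {1..l}"
  shows "card (C j) \<le> k"
proof -
  obtain A where A: "A \<in> group_partitions m l" and C: "C = (\<lambda>j\<in>{1..l}. sub (A j))"
    using assms(2) unfolding group_candidates_def by blast
  have "A j \<subseteq> {1..m}"
    using A assms(3) unfolding group_partitions_def by blast
  then have "card (sub (A j)) \<le> k"
    using assms(1) unfolding approx_subroutine_def by blast
  then show ?thesis
    using assms(3) by (simp add: C)
qed

lemma group_candidate_ge_tuple_value:
  assumes "finite \<Omega>" "1 \<le> l" "0 \<le> \<alpha>" "approx_subroutine \<alpha> \<Omega> k f m sub"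
    and T: "T \<in> feasible_tuples \<Omega> k l"
  shows "\<exists>C\<in>group_candidates m l sub. \<alpha> * tuple_value f m l T \<le> tuple_value f m l C"
proof -
  have "\<exists>j\<in>{1..l}. f i (T j) = Max ((\<lambda>j. f i (T j)) ` {1..l})" for i
    using assms(2) Max_in[of "(\<lambda>j. f i (T j)) ` {1..l}"] by fastforce
  \<comment> \<open>Fixing one maximiser \<open>g i\<close> per index settles ties, so the fibres of
    \<open>g\<close> are disjoint.\<close>
  then obtain g where g: "\<And>i. g i \<in> {1..l}"
    and max: "\<And>i. Max ((\<lambda>j. f i (T j)) ` {1..l}) = f i (T (g i))"
    by metis
  \<comment> \<open>The groups are the fibres of \<open>g\<close>. Some may be empty, which
    \<open>group_partitions\<close> permits.\<close>
  define A where "A = (\<lambda>j\<in>{1..l}. {i \<in> {1..m}. g i = j})"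
  define C where "C = (\<lambda>j\<in>{1..l}. sub (A j))"
  have "A \<in> group_partitions m l"
    using g by (auto simp: group_partitions_def A_def disjoint_family_on_def)
  then have cand: "C \<in> group_candidates m l sub"
    unfolding group_candidates_def C_def by blast
  \<comment> \<open>The tuple \<open>D\<close> is left arbitrary because the identity serves twice:
    with \<open>T\<close> to split the value to be matched into groups, and with \<open>C\<close> to
    reassemble the subroutine's answers.\<close>
  have regroup: "(\<Sum>i\<in>{1..m}. f i (D (g i))) = (\<Sum>j\<in>{1..l}. \<Sum>i\<in>A j. f i (D j))" for D
  proof -
    have "(\<Sum>i\<in>{1..m}. f i (D (g i)))
        = (\<Sum>j\<in>{1..l}. \<Sum>i\<in>{i \<in> {1..m}. g i = j}. f i (D (g i)))"
      using g by (intro sum.group[symmetric]) auto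
    also have "\<dots> = (\<Sum>j\<in>{1..l}. \<Sum>i\<in>A j. f i (D j))"
      by (intro sum.cong) (auto simp: A_def)
    finally show ?thesis .
  qed
  have "\<alpha> * tuple_value f m l T = (\<Sum>j\<in>{1..l}. \<alpha> * (\<Sum>i\<in>A j. f i (T j)))"
    unfolding tuple_value_def max regroup by (rule sum_distrib_left)
  also have "\<dots> \<le> (\<Sum>j\<in>{1..l}. \<Sum>i\<in>A j. f i (C j))"
  proof (rule sum_mono)
    fix j assume j: "j \<in> {1..l}"
    have "A j \<subseteq> {1..m}" "T j \<in> feasible_sets \<Omega> k"
      using j T by (auto simp: A_def feasible_tuples_def)
    then show "\<alpha> * (\<Sum>i\<in>A j. f i (T j)) \<le> (\<Sum>i\<in>A j. f i (C j))"
      using approx_subroutine_ge[OF assms(1,3,4)] j by (simp add: C_def)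
  qed
  also have "\<dots> = (\<Sum>i\<in>{1..m}. f i (C (g i)))"
    by (rule regroup[symmetric])
  \<comment> \<open>For \<open>T\<close> the choice \<open>g i\<close> attains the maximum, so
    splitting gave an equality. For \<open>C\<close> another position may serve \<open>i\<close>
    better, which only increases the value.\<close>
  also have "\<dots> \<le> tuple_value f m l C"
    unfolding tuple_value_def using g by (intro sum_mono Max_ge) auto
  finally show ?thesis
    using cand by blast
qed

text \<open>The subroutine's factor carries over unchanged: an optimal tuple exists by finiteness,
  some candidate comes within \<alpha> of it, and the output is at least as good as every
  candidate.\<close>

theorem group_enumeration_approximation:
  assumes "finite \<Omega>" "1 \<le> l" "0 \<le> \<alpha>" "approx_subroutine \<alpha> \<Omega> k f m sub"
    and "group_enumeration_output f m l sub S"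
  shows "\<alpha> * Max (tuple_value f m l ` feasible_tuples \<Omega> k l) \<le> tuple_value f m l S"
proof -
  have "Max (tuple_value f m l ` feasible_tuples \<Omega> k l) \<in> tuple_value f m l ` feasible_tuples \<Omega> k l"
    using finite_feasible_tuples[OF assms(1)] feasible_tuples_nonempty[of \<Omega> k l]
    by (intro Max_in) auto
  then obtain T where T: "T \<in> feasible_tuples \<Omega> k l"
    and opt: "Max (tuple_value f m l ` feasible_tuples \<Omega> k l) = tuple_value f m l T"
    by blast
  obtain C where "C \<in> group_candidates m l sub"
    and "\<alpha> * tuple_value f m l T \<le> tuple_value f m l C"
    using group_candidate_ge_tuple_value[OF assms(1-4) T] by blast
  moreover have "tuple_value f m l C \<le> tuple_value f m l S"
    using assms(5) calculation(1)
    unfolding group_enumeration_output_def is_arg_max_def by (simp add: not_less)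
  ultimately show ?thesis
    using opt by simp
qed

theorem mainTheorem3:
  fixes \<Omega> :: "'a set"
    and m l k :: nat
    and f :: "nat \<Rightarrow> 'a set \<Rightarrow> real"
    and sub :: "nat set \<Rightarrow> 'a set"
    and S :: "nat \<Rightarrow> 'a set"
  assumes "finite \<Omega>"
    and "m \<ge> 1"
    and "l \<ge> 2"
    and "\<And>i T. i \<in> {1..m} \<Longrightarrow> T \<subseteq> \<Omega> \<Longrightarrow> f i T \<ge> 0"
    and "\<And>i. i \<in> {1..m} \<Longrightarrow> mono_on (Pow \<Omega>) (f i)"
    and "\<And>i. i \<in> {1..m} \<Longrightarrow> submodular_on \<Omega> (f i)"
    and "approx_subroutine (1 - 1 / exp 1) \<Omega> k f m sub"
    and "group_enumeration_output f m l sub S"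
  shows "(\<forall>j\<in>{1..l}. card (S j) \<le> k) \<and>
    tuple_value f m l S
      \<ge> (1 - 1 / exp 1) * Max (tuple_value f m l ` feasible_tuples \<Omega> k l)"
proof
  show "\<forall>j\<in>{1..l}. card (S j) \<le> k"
    using assms(7,8) group_candidate_card_le
    unfolding group_enumeration_output_def is_arg_max_def by blast
  \<comment> \<open>The general bound asks for a nonnegative factor, which holds here since
    \<open>exp 1\<close> \<ge> 1.\<close>
  have "0 \<le> 1 - 1 / exp (1::real)"
    by simp
  then show "tuple_value f m l S
      \<ge> (1 - 1 / exp 1) * Max (tuple_value f m l ` feasible_tuples \<Omega> k l)"
    using assms(1,3,7,8) by (intro group_enumeration_approximation) auto
qed

end
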